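(* Let $G$ be a compact Lie group of dimension $d$ and let $V$ be a finite dimensional real vector space of dimension $n>d$ that is a (continuous) representation of $G$. Then every polynomial function basis $\{p_1,\dots,p_r\}\subset \mathbb{R}[V]^G$ of $V$ under the action of $G$ has cardinality not smaller than $n-d$, i.e. $r\ge n-d$.
   Context: $V$ represents $G$ means that there is a group homomorphism $G\to \mathrm{GL}(V,\mathbb{R})$, with the induced action $(g,v)\mapsto g\cdot v$ of $G$ on $V$ continuous. $\mathbb{R}[V]$ is the algebra of real polynomial functions on $V$ (generated by the dual basis of a basis of $V$), and $G$ acts on it by $(g\cdot f)(v)=f(g^{-1}\cdot v)$. $\mathbb{R}[V]^G$ is the subring of polynomials $f$ with $g\cdot f=f$ for all $g\in G$; its elements are called polynomial (algebraic) invariants. A function invariant is any function $f\colon V\to\mathbb{R}$ (not necessarily polynomial or continuous) with $f(g\cdot v)=f(v)$ for all $g\in G$, $v\in V$. A function basis is a set of function invariants such that every function invariant can be expressed as a function of the members of the set. For a finite set $\{p_1,\dots,p_r\}$ this means: for each function invariant $f$ there is a function $F$ on the image $\{(p_1(v),\dots,p_r(v)) : v\in V\}\subseteq\mathbb{R}^r$ with $f(v)=F(p_1(v),\dots,p_r(v))$ for all $v\in V$. A polynomial function basis is a finite function basis $\{p_1,\dots,p_r\}$ all of whose members are polynomial invariants, i.e. elements of $\mathbb{R}[V]^G$. *)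

theory Defs
  imports "HOL-Analysis.Analysis" "HOL-Algebra.Group"
begin

text \<open>
  \<open>\<real>\<^sup>n\<close> is the library space \<^const>\<open>Euclidean_space\<close> \<open>n\<close>, whose points are the functions
  \<^typ>\<open>nat \<Rightarrow> real\<close> vanishing from index \<open>n\<close> on. The dimension is then a natural number that may
  be 0 (finite groups are Lie groups of dimension 0) and products of manifolds have charts in
  \<open>\<real>\<^sup>m\<^sup>+\<^sup>n\<close>.
\<close>

definition partial_deriv :: "nat \<Rightarrow> ((nat \<Rightarrow> real) \<Rightarrow> real) \<Rightarrow> (nat \<Rightarrow> real) \<Rightarrow> real" where
  "partial_deriv i f x = deriv (\<lambda>t. f (x(i := t))) (x i)"

text \<open>
  \<open>Ck_on k n U f\<close>: all partial derivatives of \<open>f\<close> of order at most \<open>k\<close> exist and are continuous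
  on \<open>U\<close>. Only used for \<open>U\<close> open in \<open>\<real>\<^sup>n\<close>, so that the values of \<open>f\<close> outside \<open>U\<close> are irrelevant.
\<close>

primrec Ck_on :: "nat \<Rightarrow> nat \<Rightarrow> (nat \<Rightarrow> real) set \<Rightarrow> ((nat \<Rightarrow> real) \<Rightarrow> real) \<Rightarrow> bool" where
  "Ck_on 0 n U f \<longleftrightarrow> continuous_map (subtopology (Euclidean_space n) U) euclideanreal f"
| "Ck_on (Suc k) n U f \<longleftrightarrow>
     continuous_map (subtopology (Euclidean_space n) U) euclideanreal f \<and>
     (\<forall>i<n. (\<forall>x\<in>U. (\<lambda>t. f (x(i := t))) field_differentiable at (x i)) \<and>
            Ck_on k n U (partial_deriv i f))"

definition smooth_on ::
  "nat \<Rightarrow> nat \<Rightarrow> (nat \<Rightarrow> real) set \<Rightarrow> ((nat \<Rightarrow> real) \<Rightarrow> nat \<Rightarrow> real) \<Rightarrow> bool" where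
  "smooth_on m n U f \<longleftrightarrow> openin (Euclidean_space m) U \<and> (\<forall>j<n. \<forall>k. Ck_on k m U (\<lambda>x. f x j))"

text \<open>A chart is its domain together with its coordinate map; only the values of the
  coordinate map on the domain matter.\<close>

type_synonym 'a chart = "'a set \<times> ('a \<Rightarrow> nat \<Rightarrow> real)"

definition is_chart :: "nat \<Rightarrow> 'a topology \<Rightarrow> 'a chart \<Rightarrow> bool" where
  "is_chart n X = (\<lambda>(U, \<phi>). openin X U \<and> openin (Euclidean_space n) (\<phi> ` U) \<and>
     homeomorphic_map (subtopology X U) (subtopology (Euclidean_space n) (\<phi> ` U)) \<phi>)"

text \<open>
  The atlas need not be maximal: every smooth atlas lies in a unique maximal one, and smoothness
  of maps, as defined below, is the same for both.
\<close>

locale smooth_manifold =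
  fixes n :: nat and X :: "'a topology" and \<A> :: "'a chart set"
  assumes hausdorff: "Hausdorff_space X"
    and second_countable: "second_countable X"
    and charts: "\<And>c. c \<in> \<A> \<Longrightarrow> is_chart n X c"
    and cover: "topspace X = (\<Union>c\<in>\<A>. fst c)"
    and compatible: "\<And>U \<phi> V \<psi>. (U, \<phi>) \<in> \<A> \<Longrightarrow> (V, \<psi>) \<in> \<A> \<Longrightarrow>
           smooth_on n n (\<phi> ` (U \<inter> V)) (\<psi> \<circ> inv_into U \<phi>)"

definition smooth_map ::
  "nat \<Rightarrow> 'a topology \<Rightarrow> 'a chart set \<Rightarrow> nat \<Rightarrow> 'b topology \<Rightarrow> 'b chart set \<Rightarrow> ('a \<Rightarrow> 'b) \<Rightarrow> bool"
where
  "smooth_map m X \<A> n Y \<B> f \<longleftrightarrow> continuous_map X Y f \<and>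
     (\<forall>(U, \<phi>)\<in>\<A>. \<forall>(V, \<psi>)\<in>\<B>.
        smooth_on m n (\<phi> ` (U \<inter> f -` V)) (\<psi> \<circ> f \<circ> inv_into U \<phi>))"

definition prod_chart :: "nat \<Rightarrow> 'a chart \<Rightarrow> 'b chart \<Rightarrow> ('a \<times> 'b) chart" where
  "prod_chart m = (\<lambda>(U, \<phi>) (V, \<psi>).
     (U \<times> V, \<lambda>(x, y) i. if i < m then \<phi> x i else \<psi> y (i - m)))"

definition prod_atlas :: "nat \<Rightarrow> 'a chart set \<Rightarrow> 'b chart set \<Rightarrow> ('a \<times> 'b) chart set" where
  "prod_atlas m \<A> \<B> = {prod_chart m c c' |c c'. c \<in> \<A> \<and> c' \<in> \<B>}"

locale lie_group = group G + smooth_manifold d X \<A>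
  for G :: "('g, 'm) monoid_scheme" (structure)
    and d :: nat and X :: "'g topology" and \<A> :: "'g chart set" +
  assumes carrier: "topspace X = carrier G"
    and smooth_mult:
      "smooth_map (d + d) (prod_topology X X) (prod_atlas d \<A> \<A>) d X \<A> (\<lambda>(x, y). x \<otimes> y)"
    and smooth_inv: "smooth_map d X \<A> d X \<A> (\<lambda>x. inv x)"

locale compact_lie_group = lie_group +
  assumes compact: "compact_space X"

definition general_linear_group :: "('v::real_vector \<Rightarrow> 'v) monoid" where
  "general_linear_group = \<lparr>carrier = {f. linear f \<and> bij f}, mult = (\<circ>), one = id\<rparr>"

definition continuous_representation ::
  "('g, 'm) monoid_scheme \<Rightarrow> 'g topology \<Rightarrow> ('g \<Rightarrow> 'v \<Rightarrow> 'v::euclidean_space) \<Rightarrow> bool" where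
  "continuous_representation G X \<rho> \<longleftrightarrow>
     \<rho> \<in> hom G general_linear_group \<and>
     continuous_map (prod_topology X euclidean) euclidean (\<lambda>(g, v). \<rho> g v)"

definition function_action ::
  "('g, 'm) monoid_scheme \<Rightarrow> ('g \<Rightarrow> 'v \<Rightarrow> 'v) \<Rightarrow> 'g \<Rightarrow> ('v \<Rightarrow> real) \<Rightarrow> 'v \<Rightarrow> real" where
  "function_action G \<rho> g f = (\<lambda>v. f (\<rho> (inv\<^bsub>G\<^esub> g) v))"

definition polynomial_invariants ::
  "('g, 'm) monoid_scheme \<Rightarrow> ('g \<Rightarrow> 'v \<Rightarrow> 'v::euclidean_space) \<Rightarrow> ('v \<Rightarrow> real) set" where
  "polynomial_invariants G \<rho> =
     {f. real_polynomial_function f \<and> (\<forall>g\<in>carrier G. function_action G \<rho> g f = f)}"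

definition function_invariants ::
  "('g, 'm) monoid_scheme \<Rightarrow> ('g \<Rightarrow> 'v \<Rightarrow> 'v) \<Rightarrow> ('v \<Rightarrow> real) set" where
  "function_invariants G \<rho> = {f. \<forall>g\<in>carrier G. \<forall>v. f (\<rho> g v) = f v}"

text \<open>
  The tuple of values at \<open>v\<close> of the members of \<open>S\<close> is the point \<open>\<lambda>p\<in>S. p v\<close> of \<open>\<real>\<^sup>S\<close>, indexed
  by \<open>S\<close> itself. \<open>F\<close> is formally total, but only its values on the image of
  \<open>v \<mapsto> (\<lambda>p\<in>S. p v)\<close> matter.
\<close>

definition function_basis ::
  "('g, 'm) monoid_scheme \<Rightarrow> ('g \<Rightarrow> 'v \<Rightarrow> 'v) \<Rightarrow> ('v \<Rightarrow> real) set \<Rightarrow> bool" where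
  "function_basis G \<rho> S \<longleftrightarrow> S \<subseteq> function_invariants G \<rho> \<and>
     (\<forall>f\<in>function_invariants G \<rho>.
        \<exists>F :: (('v \<Rightarrow> real) \<Rightarrow> real) \<Rightarrow> real. \<forall>v. f v = F (\<lambda>p\<in>S. p v))"

definition polynomial_function_basis ::
  "('g, 'm) monoid_scheme \<Rightarrow> ('g \<Rightarrow> 'v \<Rightarrow> 'v::euclidean_space) \<Rightarrow> ('v \<Rightarrow> real) set \<Rightarrow> bool" where
  "polynomial_function_basis G \<rho> S \<longleftrightarrow>
     finite S \<and> function_basis G \<rho> S \<and> S \<subseteq> polynomial_invariants G \<rho>"

end

theory Submission
  imports Defs
begin

text \<open>
  A function basis separates orbits, so every joint fibre of the \<open>p\<^sub>i\<close> is a single orbit. Near a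
  point where the differentials of the \<open>p\<^sub>i\<close> have maximal rank \<open>k \<le> r\<close>, the fibres are
  \<open>(n - k)\<close>-dimensional: some subspace \<open>T\<close> of dimension at most \<open>k\<close> has the property that
  orbit plus \<open>T\<close> contains a nonempty open set. On the other hand, \<open>\<rho>\<close> is locally Lipschitz in
  charts of \<open>G\<close>, so if \<open>r + d < n\<close> then orbit plus \<open>T\<close> is a finite union of Lipschitz images of
  sets of dimension at most \<open>d + k < n\<close>, hence a null set. That a continuous representation is
  Lipschitz is elementary: an operator all of whose first \<open>N\<close> powers are within \<open>1/2\<close> of the
  identity is within \<open>1/N\<close> of the identity.
\<close>

section \<open>Fibres near a point of maximal rank\<close>

text \<open>Structural induction over polynomials. Derivatives are written as inner products with a
  gradient so that their rank can be tested by dual vectors; continuity of the gradient is needed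
  for the inverse function theorem.\<close>

lemma real_polynomial_function_gradient:
  fixes p :: "'v::euclidean_space \<Rightarrow> real"
  assumes "real_polynomial_function p"
  shows "\<exists>D. (\<forall>x. (p has_derivative (\<lambda>h. D x \<bullet> h)) (at x)) \<and> continuous_on UNIV D"
  using assms
proof (induction p rule: real_polynomial_function.induct)
  case (linear f)
  have "f h = (\<Sum>b\<in>Basis. f b *\<^sub>R b) \<bullet> h" for h
  proof -
    have "f h = f (\<Sum>b\<in>Basis. (h \<bullet> b) *\<^sub>R b)"
      by (simp add: euclidean_representation)
    also have "\<dots> = (\<Sum>b\<in>Basis. (h \<bullet> b) * f b)"
      using linear by (simp add: linear_sum linear_cmul bounded_linear.linear)
    finally show ?thesis
      by (simp add: inner_sum_left inner_commute[of h] mult.commute)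
  qed
  then have "(f has_derivative (\<lambda>h. (\<Sum>b\<in>Basis. f b *\<^sub>R b) \<bullet> h)) (at x)" for x
    by (rule has_derivative_eq_rhs[OF bounded_linear_imp_has_derivative[OF linear] ext])
  then show ?case
    by (intro exI[of _ "\<lambda>_. \<Sum>b\<in>Basis. f b *\<^sub>R b"]) auto
next
  case (const c)
  then show ?case
    by (intro exI[of _ "\<lambda>_. 0"]) auto
next
  case (add f g)
  then obtain D E where D: "\<And>x. (f has_derivative (\<lambda>h. D x \<bullet> h)) (at x)" "continuous_on UNIV D"
    and E: "\<And>x. (g has_derivative (\<lambda>h. E x \<bullet> h)) (at x)" "continuous_on UNIV E"
    by blast
  have "((\<lambda>x. f x + g x) has_derivative (\<lambda>h. (D x + E x) \<bullet> h)) (at x)" for x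
    unfolding inner_add_left by (rule has_derivative_add[OF D(1) E(1)])
  moreover have "continuous_on UNIV (\<lambda>x. D x + E x)"
    using D(2) E(2) by (rule continuous_on_add)
  ultimately show ?case
    by (intro exI[of _ "\<lambda>x. D x + E x"] conjI allI)
next
  case (mult f g)
  then obtain D E where D: "\<And>x. (f has_derivative (\<lambda>h. D x \<bullet> h)) (at x)" "continuous_on UNIV D"
    and E: "\<And>x. (g has_derivative (\<lambda>h. E x \<bullet> h)) (at x)" "continuous_on UNIV E"
    by blast
  have "continuous_on UNIV f" "continuous_on UNIV g"
    using D(1) E(1) by (meson has_derivative_continuous continuous_at_imp_continuous_on)+
  then have "continuous_on UNIV (\<lambda>x. f x *\<^sub>R E x + g x *\<^sub>R D x)"
    using D(2) E(2) by (intro continuous_on_add continuous_on_scaleR)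
  moreover have "((\<lambda>x. f x * g x) has_derivative (\<lambda>h. (f x *\<^sub>R E x + g x *\<^sub>R D x) \<bullet> h)) (at x)" for x
    by (rule has_derivative_eq_rhs[OF has_derivative_mult[OF D(1) E(1)]])
      (simp add: inner_add_left mult.commute)
  ultimately show ?case
    by (intro exI[of _ "\<lambda>x. f x *\<^sub>R E x + g x *\<^sub>R D x"] conjI allI)
qed

text \<open>A constant rank argument. Take \<open>B\<close> in \<open>S\<close> with as many
  independent gradients as possible at any point. Near that point the gradients of \<open>B\<close>
  remain independent, so by maximality every \<open>p\<close> in \<open>S\<close> is constant along
  local fibres of \<open>B\<close>; a diffeomorphism that moves points only along \<open>T\<close>
  flattens these fibres.\<close>

lemma fibre_plus_subspace_contains_open:
  fixes S :: "('v::euclidean_space \<Rightarrow> real) set"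
  assumes "finite S"
    and der: "\<And>p x. p \<in> S \<Longrightarrow> (p has_derivative (\<lambda>h. D p x \<bullet> h)) (at x)"
    and cont: "\<And>p. p \<in> S \<Longrightarrow> continuous_on UNIV (D p)"
  obtains x0 T W where "subspace T" "dim T \<le> card S" "open W" "W \<noteq> {}"
    "W \<subseteq> {x + t |x t. (\<forall>p\<in>S. p x = p x0) \<and> t \<in> T}"
proof -
  \<comment> \<open>The vectors \<open>e q\<close> witness that the gradients of \<open>B\<close> at
    \<open>x\<close> are linearly independent, so \<open>P k\<close> says that rank \<open>k\<close>
    is attained somewhere.\<close>
  define dual where "dual x B e \<longleftrightarrow> (\<forall>p\<in>B. \<forall>q\<in>B. D p x \<bullet> e q = (if p = q then 1 else 0))"
    for x B and e :: "('v \<Rightarrow> real) \<Rightarrow> 'v"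
  define P where "P k \<longleftrightarrow> (\<exists>x B e. B \<subseteq> S \<and> card B = k \<and> dual x B e)" for k
  have "P 0"
    unfolding P_def dual_def by (metis card.empty empty_iff empty_subsetI)
  moreover have "\<forall>k. P k \<longrightarrow> k \<le> card S"
    unfolding P_def using \<open>finite S\<close> card_mono by blast
  ultimately obtain k where "P k" and kmax: "\<And>j. P j \<Longrightarrow> j \<le> k"
    using Nat.ex_has_greatest_nat[of P 0 "card S"] by auto
  then obtain x0 B e where "B \<subseteq> S" "card B = k" and dual0: "dual x0 B e"
    unfolding P_def by blast
  have "finite B"
    using \<open>B \<subseteq> S\<close> \<open>finite S\<close> finite_subset by blast
  \<comment> \<open>By maximality of \<open>B\<close>: otherwise \<open>p\<close> could be added to it.\<close>
  have rank: "D p x \<bullet> h = 0"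
    if "dual x B e'" "p \<in> S" "\<And>q. q \<in> B \<Longrightarrow> D q x \<bullet> h = 0" for x e' p h
  proof (rule ccontr)
    assume nz: "D p x \<bullet> h \<noteq> 0"
    then have "p \<notin> B"
      using that by blast
    define h' where "h' = h /\<^sub>R (D p x \<bullet> h)"
    \<comment> \<open>One elimination step: \<open>h'\<close> pairs to 1 with the gradient of
      \<open>p\<close> and to 0 with those of \<open>B\<close>, so subtracting a multiple of it
      makes the gradient of \<open>p\<close> vanish on the old dual vectors.\<close>
    define e'' where "e'' q = (if q = p then h' else e' q - (D p x \<bullet> e' q) *\<^sub>R h')" for q
    have "D p x \<bullet> h' = 1" "\<And>q. q \<in> B \<Longrightarrow> D q x \<bullet> h' = 0"
      using nz that by (auto simp: h'_def)
    then have "dual x (insert p B) e''"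
      using \<open>dual x B e'\<close> \<open>p \<notin> B\<close> unfolding dual_def e''_def
      by (auto simp: inner_diff_right)
    then have "P (Suc k)"
      unfolding P_def using \<open>B \<subseteq> S\<close> \<open>p \<in> S\<close> \<open>p \<notin> B\<close> \<open>finite B\<close> \<open>card B = k\<close>
      by (intro exI[of _ x] exI[of _ "insert p B"]) auto
    then show False
      using kmax by fastforce
  qed
  define a where "a p = D p x0" for p
  have ae: "a p \<bullet> e q = (if p = q then 1 else 0)" if "p \<in> B" "q \<in> B" for p q
    using dual0 that unfolding dual_def a_def by blast
  have a_sum: "a q \<bullet> (\<Sum>p\<in>B. c p *\<^sub>R e p) = c q" if "q \<in> B" for q c
  proof -
    have "a q \<bullet> (\<Sum>p\<in>B. c p *\<^sub>R e p) = (\<Sum>p\<in>B. if q = p then c p else 0)"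
      unfolding inner_sum_right using that by (intro sum.cong) (auto simp: ae)
    then show ?thesis
      using that \<open>finite B\<close> by simp
  qed
  \<comment> \<open>Duality of \<open>e\<close> and \<open>a\<close> makes the derivative of \<open>\<Psi>\<close> at \<open>x0\<close> the identity and gives
    \<open>a q \<bullet> \<Psi> x = q x\<close>, so \<open>\<Psi>\<close> straightens the fibres of \<open>B\<close>.\<close>
  define \<Psi> where "\<Psi> x = x + (\<Sum>p\<in>B. (p x - a p \<bullet> x) *\<^sub>R e p)" for x
  define D\<Psi> where "D\<Psi> x = id_blinfun +
    (\<Sum>p\<in>B. blinfun_scaleR_left (e p) o\<^sub>L blinfun_inner_left (D p x - a p))" for x
  have D\<Psi>: "blinfun_apply (D\<Psi> x) h = h + (\<Sum>p\<in>B. (D p x \<bullet> h - a p \<bullet> h) *\<^sub>R e p)" for x h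
    by (simp add: D\<Psi>_def blinfun.add_left blinfun.sum_left inner_diff_right inner_diff_left inner_commute)
  have der\<Psi>: "(\<Psi> has_derivative blinfun_apply (D\<Psi> x)) (at x)" for x
    unfolding \<Psi>_def D\<Psi> using \<open>B \<subseteq> S\<close>
    by (auto intro!: derivative_eq_intros der)
  have cont\<Psi>: "continuous_on UNIV D\<Psi>"
    unfolding D\<Psi>_def using \<open>B \<subseteq> S\<close>
    by (auto intro!: continuous_intros cont
        bounded_linear.continuous_on[OF bounded_linear_blinfun_inner_left])
  have "D\<Psi> x0 = id_blinfun"
    by (rule blinfun_eqI) (simp add: D\<Psi> a_def)
  then have inv: "id_blinfun o\<^sub>L D\<Psi> x0 = id_blinfun"
    by (intro blinfun_eqI) simp
  obtain U V u u' where "open U" "x0 \<in> U" "open V" "\<Psi> x0 \<in> V"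
    and hom: "homeomorphism U V \<Psi> u"
    and u': "\<And>y. y \<in> V \<Longrightarrow> (u has_derivative u' y) (at y)"
      "\<And>y. y \<in> V \<Longrightarrow> u' y = inv_into UNIV (blinfun_apply (D\<Psi> (u y)))"
    and bij: "\<And>y. y \<in> V \<Longrightarrow> bij (blinfun_apply (D\<Psi> (u y)))"
    by (rule inverse_function_theorem[OF open_UNIV der\<Psi> cont\<Psi> UNIV_I inv]) blast
  have a\<Psi>: "a q \<bullet> \<Psi> x = q x" if "q \<in> B" for q x
    using that by (simp add: \<Psi>_def inner_add_right a_sum)
  have aD\<Psi>: "a q \<bullet> D\<Psi> x h = D q x \<bullet> h" if "q \<in> B" for q x h
    using that by (simp add: D\<Psi> inner_add_right a_sum)
  \<comment> \<open>Pulling \<open>e\<close> back along the bijective derivative gives a dual system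
    at each nearby point, which makes \<open>rank\<close> applicable there and not only at
    \<open>x0\<close>.\<close>
  have dual_u: "\<exists>e'. dual (u y) B e'" if "y \<in> V" for y
  proof -
    have "\<exists>h. blinfun_apply (D\<Psi> (u y)) h = e q" for q
      using bij[OF that] by (metis bij_pointE)
    then obtain e' where "\<And>q. blinfun_apply (D\<Psi> (u y)) (e' q) = e q"
      by metis
    then have "dual (u y) B e'"
      unfolding dual_def by (metis aD\<Psi> ae)
    then show ?thesis by blast
  qed
  obtain r where "r > 0" and r: "ball (\<Psi> x0) r \<subseteq> V"
    using \<open>open V\<close> \<open>\<Psi> x0 \<in> V\<close> open_contains_ball by blast
  \<comment> \<open>Follow the segment from \<open>\<Psi> x0\<close> to \<open>y\<close>, which
    stays in the ball. Its image under \<open>u\<close> has velocity killed by the gradients of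
    \<open>B\<close>, hence by the gradient of \<open>p\<close> through \<open>rank\<close>, so
    \<open>p\<close> is constant along it.\<close>
  have same_fibre: "p (u y) = p x0"
    if "p \<in> S" "y \<in> ball (\<Psi> x0) r" and eq: "\<And>q. q \<in> B \<Longrightarrow> a q \<bullet> (y - \<Psi> x0) = 0" for p y
  proof -
    define d where "d = y - \<Psi> x0"
    define c where "c t = \<Psi> x0 + t *\<^sub>R d" for t
    have cV: "c t \<in> V" if "t \<in> {0..1}" for t
    proof -
      have "norm (t *\<^sub>R d) \<le> norm d"
        using that by (simp add: mult_left_le_one_le)
      then have "c t \<in> ball (\<Psi> x0) r"
        using \<open>y \<in> _\<close> by (simp add: c_def d_def dist_norm norm_minus_commute)
      then show ?thesis
        using r by blast
    qed
    have "((\<lambda>t. p (u (c t))) has_derivative (\<lambda>h. 0)) (at t within {0..1})" if t: "t \<in> {0..1}" for t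
    proof -
      have "(c has_derivative (\<lambda>h. h *\<^sub>R d)) (at t within {0..1})"
        unfolding c_def by (auto intro!: derivative_eq_intros)
      from has_derivative_compose[OF has_derivative_compose[OF this u'(1)[OF cV[OF t]]] der[OF \<open>p \<in> S\<close>]]
      have deriv: "((\<lambda>t. p (u (c t))) has_derivative (\<lambda>h. D p (u (c t)) \<bullet> u' (c t) (h *\<^sub>R d)))
          (at t within {0..1})" .
      have lin: "linear (u' (c t))"
        using u'(1)[OF cV[OF t]] has_derivative_linear by blast
      have "blinfun_apply (D\<Psi> (u (c t))) (u' (c t) d) = d"
        using bij[OF cV[OF t]] u'(2)[OF cV[OF t]] by (simp add: bij_is_surj surj_f_inv_f)
      then have "D q (u (c t)) \<bullet> u' (c t) d = 0" if "q \<in> B" for q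
        using that eq aD\<Psi> d_def by metis
      then have "D p (u (c t)) \<bullet> u' (c t) d = 0"
        using rank dual_u[OF cV[OF t]] \<open>p \<in> S\<close> by blast
      then have "(\<lambda>h. D p (u (c t)) \<bullet> u' (c t) (h *\<^sub>R d)) = (\<lambda>h. 0)"
        using lin by (simp add: linear_cmul)
      with deriv show ?thesis
        by simp
    qed
    then have "\<exists>k. \<forall>t\<in>{0..1}. p (u (c t)) = k"
      by (intro has_derivative_zero_constant) auto
    then have "p (u (c 1)) = p (u (c 0))"
      by force
    moreover have "u (c 0) = x0"
      using hom \<open>x0 \<in> U\<close> by (simp add: c_def homeomorphism_def)
    moreover have "c 1 = y"
      by (simp add: c_def d_def)
    ultimately show ?thesis
      by simp
  qed
  \<comment> \<open>\<open>\<Psi> x - x\<close> always lies in this span.\<close>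
  define T where "T = span (e ` B)"
  have "dim T \<le> card S"
  proof -
    have "dim T \<le> card (e ` B)"
      unfolding T_def using \<open>finite B\<close> by (intro dim_le_card) auto
    also have "\<dots> \<le> card S"
      using \<open>finite B\<close> \<open>finite S\<close> \<open>B \<subseteq> S\<close> by (meson card_image_le card_mono le_trans)
    finally show ?thesis .
  qed
  \<comment> \<open>The projection of \<open>z\<close> along \<open>T\<close> onto the affine slice
    through \<open>\<Psi> x0\<close> on which all \<open>a q\<close> with \<open>q\<close> in
    \<open>B\<close> are constant. The point \<open>u (z' z)\<close> then lies in the fibre of
    \<open>x0\<close>, and both moves, from \<open>z\<close> to \<open>z' z\<close> and on to
    \<open>u (z' z)\<close>, are along \<open>T\<close>.\<close>
  define z' where "z' z = z - (\<Sum>p\<in>B. (a p \<bullet> (z - \<Psi> x0)) *\<^sub>R e p)" for z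
  have sum_T: "(\<Sum>p\<in>B. c p *\<^sub>R e p) \<in> T" for c
    unfolding T_def by (intro span_sum span_scale span_base) auto
  define W where "W = z' -` ball (\<Psi> x0) r"
  have "continuous_on UNIV z'"
    unfolding z'_def by (intro continuous_intros)
  then have "open W"
    unfolding W_def by (simp add: open_vimage)
  have "\<Psi> x0 \<in> W"
    using \<open>r > 0\<close> by (simp add: W_def z'_def)
  have W: "W \<subseteq> {x + t |x t. (\<forall>p\<in>S. p x = p x0) \<and> t \<in> T}"
  proof
    fix z assume "z \<in> W"
    then have z': "z' z \<in> ball (\<Psi> x0) r"
      by (simp add: W_def)
    have "a q \<bullet> (z' z - \<Psi> x0) = 0" if "q \<in> B" for q
      using that by (simp add: z'_def inner_diff_right a_sum)
    then have fib: "\<forall>p\<in>S. p (u (z' z)) = p x0"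
      using same_fibre z' by blast
    have "\<Psi> (u (z' z)) = z' z"
      using hom z' r by (auto simp: homeomorphism_def)
    moreover have "\<Psi> (u (z' z)) - u (z' z) \<in> T"
      unfolding \<Psi>_def using sum_T by simp
    ultimately have "z' z - u (z' z) \<in> T"
      by simp
    moreover have "z - z' z \<in> T"
      unfolding z'_def using sum_T by simp
    ultimately have "(z - z' z) + (z' z - u (z' z)) \<in> T"
      unfolding T_def by (intro span_add)
    then have "z - u (z' z) \<in> T"
      by simp
    moreover have "z = u (z' z) + (z - u (z' z))"
      by simp
    ultimately show "z \<in> {x + t |x t. (\<forall>p\<in>S. p x = p x0) \<and> t \<in> T}"
      using fib by blast
  qed
  have "subspace T"
    unfolding T_def by simp
  have "W \<noteq> {}"
    using \<open>\<Psi> x0 \<in> W\<close> by blast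
  show thesis
    by (rule that[OF \<open>subspace T\<close> \<open>dim T \<le> card S\<close> \<open>open W\<close> \<open>W \<noteq> {}\<close> W])
qed

section \<open>Lipschitz images\<close>

text \<open>The l1 metric on \<open>Euclidean_space d\<close>, whose points form no metric type. The
  l1 form makes distances in a product chart add up and makes sense for
  \<open>d = 0\<close>.\<close>

definition coord_dist :: "nat \<Rightarrow> (nat \<Rightarrow> real) \<Rightarrow> (nat \<Rightarrow> real) \<Rightarrow> real" where
  "coord_dist d x y = (\<Sum>i<d. \<bar>x i - y i\<bar>)"

text \<open>The set is a Lipschitz image of a subset of a linear space of dimension at most
  \<open>d + dim T\<close>. That subset is null because the dimension is too small, and Lipschitz
  maps between sets of the same ambient space keep null sets null.\<close>

lemma negligible_Lipschitz_plus_subspace: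
  fixes F :: "'g \<Rightarrow> 'v::euclidean_space"
  assumes T: "subspace T" "dim T + d < DIM('v)"
    and lip: "\<And>x y. x \<in> W \<Longrightarrow> y \<in> W \<Longrightarrow> norm (F x - F y) \<le> C * coord_dist d (\<phi> x) (\<phi> y)"
  shows "negligible {F x + t |x t. x \<in> W \<and> t \<in> T}"
proof -
  define T' where "T' = {y. \<forall>x\<in>T. orthogonal x y}"
  have "subspace T'"
    unfolding T'_def using subspace_orthogonal_to_vectors by blast
  have "dim T' + dim T = DIM('v)"
    using dim_subspace_orthogonal_to_vectors[OF T(1) subspace_UNIV] unfolding T'_def by simp
  then have "d \<le> dim T'"
    using T by linarith
  obtain O' where O': "O' \<subseteq> T'" "pairwise orthogonal O'" "\<And>x. x \<in> O' \<Longrightarrow> norm x = 1" "card O' = dim T'"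
    using orthonormal_basis_subspace[OF \<open>subspace T'\<close>] by metis
  have "finite O'"
    by (metis O'(2,3) norm_zero pairwise_orthogonal_independent independent_imp_finite zero_neq_one)
  \<comment> \<open>The orthogonal complement of \<open>T\<close> has dimension at least
    \<open>d\<close>, so it has room for \<open>d\<close> orthonormal vectors carrying the
    coordinates.\<close>
  then obtain b where b: "inj_on b {..<d}" "b ` {..<d} \<subseteq> O'"
    using \<open>d \<le> dim T'\<close> O'(4) card_le_inj[of "{..<d}" O'] by auto
  have bb: "b i \<bullet> b j = (if i = j then 1 else 0)" if "i < d" "j < d" for i j
  proof (cases "i = j")
    case True
    then show ?thesis
      using b(2) O'(3) that by (simp add: dot_square_norm image_subset_iff)
  next
    case False
    then have "b i \<noteq> b j"
      using b(1) that by (auto dest: inj_onD)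
    then have "orthogonal (b i) (b j)"
      using b(2) O'(2) that by (auto simp: pairwise_def image_subset_iff)
    with False show ?thesis
      by (simp add: orthogonal_def)
  qed
  have bT: "t \<bullet> b i = 0" if "i < d" "t \<in> T" for i t
    using that b(2) O'(1) unfolding T'_def by (auto simp: orthogonal_def image_subset_iff subset_iff)
  \<comment> \<open>Since the \<open>b i\<close> are orthonormal and orthogonal to \<open>T\<close>,
    both the coordinates of \<open>x\<close> (by \<open>hb\<close>) and the summand \<open>t\<close>
    (by \<open>h_diff\<close>) can be recovered linearly from \<open>h x t\<close>.\<close>
  define h where "h x t = (\<Sum>i<d. \<phi> x i *\<^sub>R b i) + t" for x t
  have hb: "h x t \<bullet> b j = \<phi> x j" if "j < d" "t \<in> T" for x t j
  proof -
    have "h x t \<bullet> b j = (\<Sum>i<d. \<phi> x i * (b i \<bullet> b j))"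
      using that by (simp add: h_def inner_add_left inner_sum_left bT)
    also have "\<dots> = (\<Sum>i<d. if i = j then \<phi> x i else 0)"
      using that by (intro sum.cong) (auto simp: bb)
    finally show ?thesis
      using that by simp
  qed
  have h_diff: "t - t' = (h x t - h x' t') - (\<Sum>i<d. ((h x t - h x' t') \<bullet> b i) *\<^sub>R b i)"
    if "t \<in> T" "t' \<in> T" for x t x' t'
  proof -
    have "(\<Sum>i<d. ((h x t - h x' t') \<bullet> b i) *\<^sub>R b i) = (\<Sum>i<d. \<phi> x i *\<^sub>R b i) - (\<Sum>i<d. \<phi> x' i *\<^sub>R b i)"
      unfolding sum_subtractf[symmetric]
      by (intro sum.cong) (auto simp: inner_diff_left hb that scaleR_diff_left)
    then show ?thesis
      by (simp add: h_def)
  qed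
  define N where "N = {h x t |x t. x \<in> W \<and> t \<in> T}"
  have "negligible N"
  proof (rule negligible_lowdim)
    obtain BT where BT: "BT \<subseteq> T" "independent BT" "T \<subseteq> span BT" "card BT = dim T"
      using basis_exists[of T] by metis
    have "finite BT"
      using BT independent_imp_finite by blast
    have "N \<subseteq> span (b ` {..<d} \<union> BT)"
    proof -
      have "h x t \<in> span (b ` {..<d} \<union> BT)" if "t \<in> T" for x t
      proof -
        have "t \<in> span (b ` {..<d} \<union> BT)"
          using that BT(3) span_mono[of BT "b ` {..<d} \<union> BT"] by blast
        then show ?thesis
          unfolding h_def by (intro span_add span_sum span_scale) (auto intro: span_base)
      qed
      then show ?thesis
        unfolding N_def by blast
    qed
    then have "dim N \<le> card (b ` {..<d} \<union> BT)"
      using \<open>finite BT\<close> by (intro dim_le_card) auto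
    also have "\<dots> \<le> d + dim T"
      using BT(4) card_image_le[of "{..<d}" b] card_Un_le[of "b ` {..<d}" BT] by simp
    finally show "dim N < DIM('v)"
      using T by linarith
  qed
  have "\<forall>y\<in>N. \<exists>x t. x \<in> W \<and> t \<in> T \<and> y = h x t"
    unfolding N_def by blast
  then obtain \<xi> \<tau> where xt: "\<And>y. y \<in> N \<Longrightarrow> \<xi> y \<in> W \<and> \<tau> y \<in> T \<and> y = h (\<xi> y) (\<tau> y)"
    by metis
  define f where "f y = F (\<xi> y) + \<tau> y" for y
  have coord: "coord_dist d (\<phi> (\<xi> y)) (\<phi> x) \<le> d * norm (y - h x t)" if "y \<in> N" "t \<in> T" for y x t
  proof -
    have "\<bar>\<phi> (\<xi> y) i - \<phi> x i\<bar> \<le> norm (y - h x t)" if "i < d" for i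
    proof -
      have "\<phi> (\<xi> y) i - \<phi> x i = (y - h x t) \<bullet> b i"
        using xt[OF \<open>y \<in> N\<close>] hb \<open>t \<in> T\<close> that by (metis inner_diff_left)
      also have "\<bar>\<dots>\<bar> \<le> norm (y - h x t) * norm (b i)"
        by (rule Cauchy_Schwarz_ineq2)
      also have "norm (b i) = 1"
        using b(2) O'(3) that by auto
      finally show ?thesis by simp
    qed
    then show ?thesis
      unfolding coord_dist_def using sum_bounded_above[of "{..<d}" _ "norm (y - h x t)"] by fastforce
  qed
  \<comment> \<open>The first summand bounds the change of \<open>F\<close>, with
    \<open>\<bar>C\<bar>\<close> because the sign of \<open>C\<close> is not fixed; the second
    bounds the change of \<open>t\<close>, recovered by subtracting \<open>d\<close>
    projections.\<close>
  define K where "K = \<bar>C\<bar> * d + (1 + d)"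
  \<comment> \<open>The pair \<open>x\<close>, \<open>t\<close> is arbitrary and need not be the
    chosen preimage. For \<open>y = h x t\<close> the bound gives \<open>f y = F x + t\<close>, so
    the choice of \<open>\<xi>\<close> and \<open>\<tau>\<close> is immaterial although
    \<open>\<phi>\<close> may fail to be injective.\<close>
  have f_lip: "norm (f y - (F x + t)) \<le> K * norm (y - h x t)"
    if y: "y \<in> N" and x: "x \<in> W" and t: "t \<in> T" for y x t
  proof -
    let ?n = "norm (y - h x t)"
    have "norm (F (\<xi> y) - F x) \<le> C * coord_dist d (\<phi> (\<xi> y)) (\<phi> x)"
      using lip xt y x by blast
    also have "\<dots> \<le> \<bar>C\<bar> * coord_dist d (\<phi> (\<xi> y)) (\<phi> x)"
      by (intro mult_right_mono) (auto simp: coord_dist_def sum_nonneg)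
    also have "\<dots> \<le> \<bar>C\<bar> * (d * ?n)"
      by (intro mult_left_mono coord y t) auto
    finally have 1: "norm (F (\<xi> y) - F x) \<le> \<bar>C\<bar> * (d * ?n)" .
    have "\<tau> y - t = (y - h x t) - (\<Sum>i<d. ((y - h x t) \<bullet> b i) *\<^sub>R b i)"
      using h_diff[of "\<tau> y" t "\<xi> y" x] xt[OF y] t by simp
    also have "norm \<dots> \<le> ?n + norm (\<Sum>i<d. ((y - h x t) \<bullet> b i) *\<^sub>R b i)"
      by (rule norm_triangle_ineq4)
    also have "norm (\<Sum>i<d. ((y - h x t) \<bullet> b i) *\<^sub>R b i) \<le> real (card {..<d}) * ?n"
    proof (rule sum_norm_bound)
      fix i assume "i \<in> {..<d}"
      then have "norm (b i) = 1"
        using b(2) O'(3) by auto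
      then show "norm (((y - h x t) \<bullet> b i) *\<^sub>R b i) \<le> ?n"
        using Cauchy_Schwarz_ineq2[of "y - h x t" "b i"] by simp
    qed
    finally have 2: "norm (\<tau> y - t) \<le> (1 + d) * ?n"
      by (simp add: algebra_simps)
    have "f y - (F x + t) = (F (\<xi> y) - F x) + (\<tau> y - t)"
      by (simp add: f_def)
    then have "norm (f y - (F x + t)) \<le> norm (F (\<xi> y) - F x) + norm (\<tau> y - t)"
      by (metis norm_triangle_ineq)
    with 1 2 show ?thesis
      by (simp add: K_def algebra_simps)
  qed
  have "negligible (f ` N)"
  proof (rule negligible_locally_Lipschitz_image[OF _ \<open>negligible N\<close>])
    fix x assume x: "x \<in> N"
    have "norm (f y - f x) \<le> K * norm (y - x)" if "y \<in> N" for y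
      using f_lip[OF that, of "\<xi> x" "\<tau> x"] xt[OF x] by (simp add: f_def)
    then show "\<exists>T B. open T \<and> x \<in> T \<and> (\<forall>y\<in>N \<inter> T. norm (f y - f x) \<le> B * norm (y - x))"
      by (intro exI[of _ UNIV] exI[of _ K]) auto
  qed simp
  moreover have "{F x + t |x t. x \<in> W \<and> t \<in> T} \<subseteq> f ` N"
  proof clarify
    fix x t assume "x \<in> W" "t \<in> T"
    then have "h x t \<in> N"
      unfolding N_def by blast
    with f_lip[OF this \<open>x \<in> W\<close> \<open>t \<in> T\<close>] show "F x + t \<in> f ` N"
      by (intro image_eqI[of _ _ "h x t"]) auto
  qed
  ultimately show ?thesis
    using negligible_subset by blast
qed

section \<open>Coordinates on manifolds and Lie groups\<close>

lemma coord_dist_nonneg: "0 \<le> coord_dist d x y"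
  by (simp add: coord_dist_def sum_nonneg)

lemma coord_dist_refl [simp]: "coord_dist d x x = 0"
  by (simp add: coord_dist_def)

lemma coord_dist_commute: "coord_dist d x y = coord_dist d y x"
  by (simp add: coord_dist_def abs_minus_commute)

lemma coord_dist_triangle: "coord_dist d x z \<le> coord_dist d x y + coord_dist d y z"
  unfolding coord_dist_def sum.distrib[symmetric] by (rule sum_mono) linarith

lemma coord_le_coord_dist: "i < d \<Longrightarrow> \<bar>x i - y i\<bar> \<le> coord_dist d x y"
  unfolding coord_dist_def by (rule member_le_sum) auto

lemma continuous_map_coord_dist:
  assumes "continuous_map X (Euclidean_space d) f"
  shows "continuous_map X euclideanreal (\<lambda>x. coord_dist d (f x) c)"
proof -
  have "continuous_map X euclideanreal (\<lambda>x. f x i)" for i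
    using assms unfolding Euclidean_space_def continuous_map_in_subtopology
    by (simp add: continuous_map_componentwise_UNIV)
  then show ?thesis
    unfolding coord_dist_def
    by (intro continuous_map_sum continuous_map_real_abs continuous_map_diff) auto
qed

text \<open>An open set of the product topology contains a box around \<open>p\<close>. Coordinates
  from \<open>m\<close> on vanish at both points, so only finitely many sides of the box constrain
  the radius.\<close>

lemma openin_Euclidean_space_ball:
  assumes "openin (Euclidean_space m) U" "p \<in> U"
  obtains e where "e > 0"
    "\<And>q. q \<in> topspace (Euclidean_space m) \<Longrightarrow> coord_dist m q p < e \<Longrightarrow> q \<in> U"
proof -
  obtain V where V: "openin (powertop_real UNIV) V" "U = V \<inter> {x. \<forall>i\<ge>m. x i = 0}"
    using assms(1) unfolding Euclidean_space_def openin_subtopology by blast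
  have "p \<in> V"
    using V(2) assms(2) by blast
  then obtain Y where Y: "\<And>i. open (Y i)" "p \<in> Pi\<^sub>E UNIV Y" "Pi\<^sub>E UNIV Y \<subseteq> V"
    using V(1) unfolding openin_product_topology_alt by simp metis
  have "\<exists>e>0. \<forall>t. \<bar>t - p i\<bar> < e \<longrightarrow> t \<in> Y i" for i
    using Y(1)[of i] Y(2) unfolding open_dist by (auto simp: dist_real_def PiE_iff)
  then obtain e where e: "\<And>i. e i > 0" "\<And>i t. \<bar>t - p i\<bar> < e i \<Longrightarrow> t \<in> Y i"
    by metis
  \<comment> \<open>The inserted 1 keeps the set nonempty when \<open>m = 0\<close>.\<close>
  define r where "r = Min (insert 1 (e ` {..<m}))"
  have "r > 0"
    unfolding r_def using e(1) by (subst Min_gr_iff) auto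
  moreover have "q \<in> U" if q: "q \<in> topspace (Euclidean_space m)" "coord_dist m q p < r" for q
  proof -
    have "q i \<in> Y i" for i
    proof (cases "i < m")
      case True
      then have "r \<le> e i"
        unfolding r_def by (intro Min_le) auto
      then show ?thesis
        using e(2) q(2) coord_le_coord_dist[OF True, of q p] by force
    next
      case False
      then have "q i = p i"
        using q(1) V(2) assms(2) by (auto simp: topspace_Euclidean_space)
      then show ?thesis
        using Y(2) by auto
    qed
    then have "q \<in> V"
      using Y(3) by auto
    then show ?thesis
      using q(1) V(2) by (auto simp: topspace_Euclidean_space)
  qed
  ultimately show thesis
    using that by blast
qed

text \<open>Continuous partial derivatives are bounded near \<open>p\<close>; changing one
  coordinate at a time, the mean value bound applies to each change separately.\<close>

lemma Ck_1_locally_Lipschitz: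
  assumes U: "openin (Euclidean_space m) U" "p \<in> U" and f: "Ck_on (Suc 0) m U f"
  obtains e M where "e > 0" "M \<ge> 0"
    "\<And>x y. x \<in> topspace (Euclidean_space m) \<Longrightarrow> y \<in> topspace (Euclidean_space m) \<Longrightarrow>
      coord_dist m x p < e \<Longrightarrow> coord_dist m y p < e \<Longrightarrow> \<bar>f x - f y\<bar> \<le> M * coord_dist m x y"
proof -
  define g where "g i = partial_deriv i f" for i
  have diff: "(\<lambda>t. f (x(i := t))) field_differentiable at (x i)" if "i < m" "x \<in> U" for x i
    using f that by simp
  have g: "continuous_map (subtopology (Euclidean_space m) U) euclideanreal (g i)" if "i < m" for i
    using f that by (simp add: g_def)
  \<comment> \<open>On \<open>V\<close> each partial derivative differs from its value at
    \<open>p\<close> by less than 1, which yields the common bound \<open>M\<close>.\<close>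
  define V where "V = {x \<in> U. (\<Sum>i<m. \<bar>g i x - g i p\<bar>) < 1}"
  have "continuous_map (subtopology (Euclidean_space m) U) euclideanreal (\<lambda>x. \<Sum>i<m. \<bar>g i x - g i p\<bar>)"
    using g by (intro continuous_map_sum continuous_map_real_abs continuous_map_diff) auto
  from openin_continuous_map_preimage[OF this, of "{..<1}"]
  have "openin (subtopology (Euclidean_space m) U) V"
    using openin_subset[OF U(1)] by (simp add: V_def Int_absorb1)
  then have "openin (Euclidean_space m) V"
    using U(1) openin_trans_full by blast
  moreover have "p \<in> V"
    using U by (simp add: V_def)
  ultimately obtain r where "r > 0"
    and r: "\<And>q. q \<in> topspace (Euclidean_space m) \<Longrightarrow> coord_dist m q p < r \<Longrightarrow> q \<in> V"
    using openin_Euclidean_space_ball by blast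
  define M where "M = (\<Sum>i<m. \<bar>g i p\<bar>) + 1"
  have "M \<ge> 0"
    by (simp add: M_def add_nonneg_nonneg sum_nonneg)
  have gM: "\<bar>g i x\<bar> \<le> M" if "i < m" "x \<in> V" for i x
  proof -
    have "\<bar>g i x - g i p\<bar> \<le> (\<Sum>i<m. \<bar>g i x - g i p\<bar>)"
      using that by (intro member_le_sum) auto
    moreover have "\<bar>g i p\<bar> \<le> (\<Sum>i<m. \<bar>g i p\<bar>)"
      using that by (intro member_le_sum) auto
    moreover have "(\<Sum>i<m. \<bar>g i x - g i p\<bar>) < 1"
      using that unfolding V_def by simp
    ultimately show ?thesis
      unfolding M_def by linarith
  qed
  have "\<bar>f x - f y\<bar> \<le> M * coord_dist m x y"
    if x: "x \<in> topspace (Euclidean_space m)" "coord_dist m x p < r / 2"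
      and y: "y \<in> topspace (Euclidean_space m)" "coord_dist m y p < r / 2" for x y
  proof -
    \<comment> \<open>A path of \<open>m\<close> steps from \<open>x\<close> to \<open>y\<close>,
      replacing one coordinate per step. Its points may be as far from \<open>p\<close> as
      \<open>x\<close> and \<open>y\<close> together, hence the radius \<open>r / 2\<close>.\<close>
    define z where "z k i = (if i < k then y i else x i)" for k i :: nat
    have step: "\<bar>f (z (Suc k)) - f (z k)\<bar> \<le> M * \<bar>x k - y k\<bar>" if "k < m" for k
    proof -
      define h where "h = (\<lambda>t. f ((z k)(k := t)))"
      have V: "(z k)(k := t) \<in> V" if t: "t \<in> closed_segment (x k) (y k)" for t
      proof (rule r)
        show "(z k)(k := t) \<in> topspace (Euclidean_space m)"
          using x(1) y(1) \<open>k < m\<close> by (simp add: topspace_Euclidean_space z_def)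
        have "\<bar>t - p k\<bar> \<le> \<bar>x k - p k\<bar> + \<bar>y k - p k\<bar>"
          using t unfolding closed_segment_eq_real_ivl by (auto split: if_splits)
        then have "\<bar>((z k)(k := t)) i - p i\<bar> \<le> \<bar>x i - p i\<bar> + \<bar>y i - p i\<bar>" for i
          by (auto simp: z_def)
        then have "coord_dist m ((z k)(k := t)) p \<le> coord_dist m x p + coord_dist m y p"
          unfolding coord_dist_def sum.distrib[symmetric] by (intro sum_mono) blast
        then show "coord_dist m ((z k)(k := t)) p < r"
          using x(2) y(2) by linarith
      qed
      have "(h has_field_derivative g k ((z k)(k := t))) (at t within closed_segment (x k) (y k))"
        if t: "t \<in> closed_segment (x k) (y k)" for t
      proof -
        have "(z k)(k := t) \<in> U"
          using V[OF t] V_def by blast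
        from diff[OF \<open>k < m\<close> this] have "h field_differentiable at t"
          by (simp add: h_def)
        then have "(h has_field_derivative deriv h t) (at t)"
          by (rule field_differentiable_derivI)
        moreover have "deriv h t = g k ((z k)(k := t))"
          by (simp add: g_def partial_deriv_def h_def)
        ultimately show ?thesis
          using has_field_derivative_at_within by metis
      qed
      then have "norm (h (y k) - h (x k)) \<le> M * norm (y k - x k)"
        by (rule field_differentiable_bound[rotated]) (use V gM \<open>k < m\<close> in auto)
      moreover have "(z k)(k := y k) = z (Suc k)" "(z k)(k := x k) = z k"
        by (auto simp: z_def fun_eq_iff)
      ultimately show ?thesis
        by (simp add: h_def abs_minus_commute)
    qed
    have "z 0 = x" "z m = y"
      using x(1) y(1) by (auto simp: z_def fun_eq_iff topspace_Euclidean_space)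
    then have eq: "f y - f x = (\<Sum>k<m. f (z (Suc k)) - f (z k))"
      using sum_lessThan_telescope[of "\<lambda>k. f (z k)" m] by simp
    have "\<bar>f x - f y\<bar> \<le> (\<Sum>k<m. \<bar>f (z (Suc k)) - f (z k)\<bar>)"
      unfolding abs_minus_commute[of "f x"] eq by (rule sum_abs)
    also have "\<dots> \<le> (\<Sum>k<m. M * \<bar>x k - y k\<bar>)"
      using step by (intro sum_mono) auto
    finally show ?thesis
      by (simp add: coord_dist_def sum_distrib_left)
  qed
  then show thesis
    using that[of "r / 2" M] \<open>r > 0\<close> \<open>M \<ge> 0\<close> by simp
qed

lemma smooth_on_locally_Lipschitz:
  assumes f: "smooth_on m n U f" and "p \<in> U"
  obtains e M where "e > 0" "M \<ge> 0"
    "\<And>x. x \<in> topspace (Euclidean_space m) \<Longrightarrow> coord_dist m x p < e \<Longrightarrow> x \<in> U"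
    "\<And>x y. x \<in> topspace (Euclidean_space m) \<Longrightarrow> y \<in> topspace (Euclidean_space m) \<Longrightarrow>
      coord_dist m x p < e \<Longrightarrow> coord_dist m y p < e \<Longrightarrow>
      coord_dist n (f x) (f y) \<le> M * coord_dist m x y"
proof -
  let ?E = "topspace (Euclidean_space m)"
  have U: "openin (Euclidean_space m) U" and Ck: "\<And>j. j < n \<Longrightarrow> Ck_on (Suc 0) m U (\<lambda>x. f x j)"
    using f by (auto simp: smooth_on_def simp del: Ck_on.simps)
  obtain r where "r > 0" and r: "\<And>x. x \<in> ?E \<Longrightarrow> coord_dist m x p < r \<Longrightarrow> x \<in> U"
    using openin_Euclidean_space_ball[OF U \<open>p \<in> U\<close>] by blast
  have "\<exists>e M. e > 0 \<and> M \<ge> 0 \<and> (\<forall>x\<in>?E. \<forall>y\<in>?E. coord_dist m x p < e \<longrightarrow> coord_dist m y p < e \<longrightarrow>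
      \<bar>f x j - f y j\<bar> \<le> M * coord_dist m x y)" if "j < n" for j
    using Ck_1_locally_Lipschitz[OF U \<open>p \<in> U\<close> Ck[OF that]] by metis
  then obtain e M where eM: "\<And>j. j < n \<Longrightarrow> e j > 0 \<and> M j \<ge> 0 \<and> (\<forall>x\<in>?E. \<forall>y\<in>?E.
      coord_dist m x p < e j \<longrightarrow> coord_dist m y p < e j \<longrightarrow> \<bar>f x j - f y j\<bar> \<le> M j * coord_dist m x y)"
    by metis
  define s where "s = Min (insert r (e ` {..<n}))"
  have "s > 0"
    unfolding s_def using eM \<open>r > 0\<close> by (subst Min_gr_iff) auto
  have s: "s \<le> r" "\<And>j. j < n \<Longrightarrow> s \<le> e j"
    unfolding s_def by (auto intro!: Min_le)
  show thesis
  proof (rule that)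
    show "s > 0" by fact
    show "(\<Sum>j<n. M j) \<ge> 0"
      using eM by (intro sum_nonneg) auto
    show "x \<in> U" if "x \<in> ?E" "coord_dist m x p < s" for x
      using r s that by force
    show "coord_dist n (f x) (f y) \<le> (\<Sum>j<n. M j) * coord_dist m x y"
      if "x \<in> ?E" "y \<in> ?E" "coord_dist m x p < s" "coord_dist m y p < s" for x y
      unfolding coord_dist_def[of n] sum_distrib_right
    proof (rule sum_mono)
      fix j assume "j \<in> {..<n}"
      then show "\<bar>f x j - f y j\<bar> \<le> M j * coord_dist m x y"
        using eM[of j] s(2)[of j] that by auto
    qed
  qed
qed

section \<open>Charts and coordinate balls\<close>

context smooth_manifold
begin

lemma chart_props:
  assumes "(U, \<phi>) \<in> \<A>"
  shows "openin X U" "inj_on \<phi> U" "continuous_map (subtopology X U) (Euclidean_space n) \<phi>"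
    "\<And>x. x \<in> U \<Longrightarrow> \<phi> x \<in> topspace (Euclidean_space n)"
    "\<And>N. openin X N \<Longrightarrow> openin (Euclidean_space n) (\<phi> ` (U \<inter> N))"
proof -
  let ?E = "subtopology (Euclidean_space n) (\<phi> ` U)"
  have U: "openin X U" and \<phi>U: "openin (Euclidean_space n) (\<phi> ` U)"
    and hom: "homeomorphic_map (subtopology X U) ?E \<phi>"
    using charts[OF assms] by (auto simp: is_chart_def)
  have top: "topspace (subtopology X U) = U"
    using openin_subset[OF U] by auto
  show "openin X U" by fact
  show "inj_on \<phi> U"
    using homeomorphic_imp_injective_map[OF hom] unfolding top .
  show "continuous_map (subtopology X U) (Euclidean_space n) \<phi>"
    using homeomorphic_imp_continuous_map[OF hom] by (simp add: continuous_map_in_subtopology)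
  show "\<phi> x \<in> topspace (Euclidean_space n)" if "x \<in> U" for x
    using openin_subset[OF \<phi>U] that by blast
  show "openin (Euclidean_space n) (\<phi> ` (U \<inter> N))" if "openin X N" for N
  proof -
    have "openin (subtopology X U) (U \<inter> N)"
      using that by (auto simp: openin_subtopology)
    then have "openin ?E (\<phi> ` (U \<inter> N))"
      using homeomorphic_imp_open_map[OF hom] unfolding open_map_def by blast
    then show ?thesis
      using \<phi>U openin_trans_full by blast
  qed
qed

lemma chart_at:
  assumes "x \<in> topspace X"
  obtains U \<phi> where "(U, \<phi>) \<in> \<A>" "x \<in> U"
  using assms cover by auto

lemma openin_chart_ball:
  assumes "(U, \<phi>) \<in> \<A>"
  shows "openin X {x \<in> U. coord_dist n (\<phi> x) c < r}"
proof -
  have "openin (subtopology X U)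
      {x \<in> topspace (subtopology X U). coord_dist n (\<phi> x) c \<in> {..<r}}"
    by (rule openin_continuous_map_preimage[OF continuous_map_coord_dist[OF chart_props(3)[OF assms]]])
      simp
  moreover have "topspace (subtopology X U) = U"
    using openin_subset[OF chart_props(1)[OF assms]] by auto
  ultimately have "openin (subtopology X U) {x \<in> U. coord_dist n (\<phi> x) c < r}"
    by (simp only: lessThan_iff)
  then show ?thesis
    using openin_trans_full[OF _ chart_props(1)[OF assms]] by blast
qed

text \<open>Charts are open and injective, so coordinate balls form a neighbourhood base at
  \<open>g\<close>.\<close>

lemma chart_ball_within:
  assumes \<phi>: "(U, \<phi>) \<in> \<A>" and N: "openin X N" "g \<in> N" "g \<in> U"
  obtains r where "r > 0" "\<And>x. x \<in> U \<Longrightarrow> coord_dist n (\<phi> x) (\<phi> g) < r \<Longrightarrow> x \<in> N"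
proof -
  obtain r where "r > 0" and r: "\<And>q. q \<in> topspace (Euclidean_space n) \<Longrightarrow>
      coord_dist n q (\<phi> g) < r \<Longrightarrow> q \<in> \<phi> ` (U \<inter> N)"
    using openin_Euclidean_space_ball[OF chart_props(5)[OF \<phi> N(1)] imageI[of g]] N(2,3)
    by (metis IntI)
  have "x \<in> N" if "x \<in> U" "coord_dist n (\<phi> x) (\<phi> g) < r" for x
    using r[OF chart_props(4)[OF \<phi> that(1)] that(2)] chart_props(2)[OF \<phi>] that(1)
    by (auto dest: inj_onD)
  with \<open>r > 0\<close> show thesis
    by (rule that)
qed

lemma chart_eqI:
  assumes \<phi>: "(U, \<phi>) \<in> \<A>" "x \<in> U" "y \<in> U" and "coord_dist n (\<phi> x) (\<phi> y) = 0"
  shows "x = y"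
proof -
  have "\<phi> x i = \<phi> y i" for i
  proof (cases "i < n")
    case True
    then show ?thesis
      using coord_le_coord_dist[OF True, of "\<phi> x" "\<phi> y"] assms(4) by simp
  next
    case False
    then show ?thesis
      using chart_props(4)[OF \<phi>(1)] \<phi>(2,3) by (simp add: topspace_Euclidean_space)
  qed
  then show ?thesis
    using chart_props(2)[OF \<phi>(1)] \<phi>(2,3) by (auto dest: inj_onD)
qed

end

text \<open>With \<open>w = T v - v\<close> the sum of \<open>(T ^^ k) w\<close> over
  \<open>k < N\<close> telescopes to \<open>(T ^^ N) v - v\<close>. Each term is within
  \<open>norm w / 2\<close> of \<open>w\<close>, so the sum differs from \<open>N\<close> times
  \<open>w\<close> by at most half of its norm, which can be absorbed.\<close>

lemma linear_small_powers:
  fixes T :: "'v::real_normed_vector \<Rightarrow> 'v"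
  assumes T: "linear T" and N: "0 < N"
    and small: "\<And>k v. k \<le> N \<Longrightarrow> norm ((T ^^ k) v - v) \<le> norm v / 2"
  shows "norm (T v - v) \<le> norm v / N"
proof -
  define w where "w = T v - v"
  have lin: "linear (T ^^ k)" for k
  proof (induction k)
    case 0
    then show ?case by (simp add: linear_iff)
  next
    case (Suc k)
    then show ?case
      unfolding funpow.simps by (rule linear_compose[OF _ T])
  qed
  have "(\<Sum>k<N. (T ^^ k) w) = (\<Sum>k<N. (T ^^ Suc k) v - (T ^^ k) v)"
    by (simp add: w_def linear_diff[OF lin] funpow_swap1)
  also have "\<dots> = (T ^^ N) v - v"
    by (subst sum_lessThan_telescope) simp
  finally have sum: "real N *\<^sub>R w = ((T ^^ N) v - v) - (\<Sum>k<N. (T ^^ k) w - w)"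
    by (simp add: sum_subtractf scaleR_conv_of_real sum_constant_scaleR)
  have "real N * norm w = norm (real N *\<^sub>R w)"
    by simp
  also have "\<dots> \<le> norm ((T ^^ N) v - v) + norm (\<Sum>k<N. (T ^^ k) w - w)"
    unfolding sum by (rule norm_triangle_ineq4)
  also have "norm (\<Sum>k<N. (T ^^ k) w - w) \<le> (\<Sum>k<N. norm w / 2)"
    using small by (intro sum_norm_le) auto
  also have "norm ((T ^^ N) v - v) \<le> norm v / 2"
    using small by simp
  finally have "real N * norm w \<le> norm v"
    by simp
  then show ?thesis
    using N by (simp add: w_def field_simps)
qed

section \<open>Lipschitz bounds for the group multiplication\<close>

context lie_group
begin

lemma openin_inv_vimage:
  assumes "openin X N"
  shows "openin X {x \<in> carrier G. inv x \<in> N}"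
proof -
  have "continuous_map X X (\<lambda>x. inv x)"
    using smooth_inv by (simp add: smooth_map_def)
  from openin_continuous_map_preimage[OF this assms] show ?thesis
    by (simp add: carrier)
qed

text \<open>Smoothness in the product chart gives a Lipschitz bound whose constant is uniform in the
  left factor \<open>a\<close>. This uniformity is used with \<open>a\<close> a power of
  \<open>x\<close>, and with \<open>a = inv x\<close> to translate to the unit.\<close>

lemma mult_locally_Lipschitz:
  assumes charts: "(U', \<theta>) \<in> \<A>" "(V, \<psi>) \<in> \<A>" "(U, \<phi>) \<in> \<A>"
    and mem: "g \<in> U'" "h \<in> V" "g \<otimes> h \<in> U"
  obtains N M C where "openin X N" "openin X M" "g \<in> N" "h \<in> M" "M \<subseteq> V" "C \<ge> 0"
    "\<And>a y. a \<in> N \<Longrightarrow> y \<in> M \<Longrightarrow> a \<otimes> y \<in> U"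
    "\<And>a x y. a \<in> N \<Longrightarrow> x \<in> M \<Longrightarrow> y \<in> M \<Longrightarrow>
      coord_dist d (\<phi> (a \<otimes> x)) (\<phi> (a \<otimes> y)) \<le> C * coord_dist d (\<psi> x) (\<psi> y)"
proof -
  define \<Phi> where "\<Phi> = (\<lambda>(x, y) i. if i < d then \<theta> x i else \<psi> y (i - d))"
  define mul where "mul = (\<lambda>(x, y). x \<otimes> y)"
  define P where "P = (U' \<times> V) \<inter> mul -` U"
  define f where "f = \<phi> \<circ> mul \<circ> inv_into (U' \<times> V) \<Phi>"
  have "(U' \<times> V, \<Phi>) = prod_chart d (U', \<theta>) (V, \<psi>)"
    by (simp add: prod_chart_def \<Phi>_def)
  then have "(U' \<times> V, \<Phi>) \<in> prod_atlas d \<A> \<A>"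
    unfolding prod_atlas_def using charts by blast
  then have smooth: "smooth_on (d + d) d (\<Phi> ` P) f"
    using smooth_mult charts(3) unfolding smooth_map_def mul_def P_def f_def by blast
  have in_E: "\<Phi> (a, x) \<in> topspace (Euclidean_space (d + d))" if "a \<in> U'" "x \<in> V" for a x
    using chart_props(4)[OF charts(2) that(2)] by (auto simp: topspace_Euclidean_space \<Phi>_def)
  \<comment> \<open>Additivity makes a change of the second factor alone cost only the
    \<open>\<psi>\<close>-distance.\<close>
  have dist: "coord_dist (d + d) (\<Phi> (a, x)) (\<Phi> (b, y))
      = coord_dist d (\<theta> a) (\<theta> b) + coord_dist d (\<psi> x) (\<psi> y)" for a b x y
  proof -
    have "{..<d + d} = {..<d} \<union> {d..<d + d}" "{..<d} \<inter> {d..<d + d} = {}"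
      by auto
    then have "coord_dist (d + d) (\<Phi> (a, x)) (\<Phi> (b, y))
        = (\<Sum>i<d. \<bar>\<theta> a i - \<theta> b i\<bar>) + (\<Sum>i=d..<d + d. \<bar>\<psi> x (i - d) - \<psi> y (i - d)\<bar>)"
      by (simp add: coord_dist_def \<Phi>_def sum.union_disjoint)
    also have "(\<Sum>i=d..<d + d. \<bar>\<psi> x (i - d) - \<psi> y (i - d)\<bar>) = (\<Sum>i<d. \<bar>\<psi> x i - \<psi> y i\<bar>)"
      using sum.shift_bounds_nat_ivl[of "\<lambda>i. \<bar>\<psi> x (i - d) - \<psi> y (i - d)\<bar>" 0 d d]
      by (simp add: atLeast0LessThan)
    finally show ?thesis
      by (simp add: coord_dist_def)
  qed
  \<comment> \<open>\<open>smooth_map\<close> expresses maps through \<open>inv_into\<close>, which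
    returns to the given pair only for an injective chart.\<close>
  have inj: "inj_on \<Phi> (U' \<times> V)"
  proof (rule inj_onI, clarify)
    fix a x b y assume *: "a \<in> U'" "x \<in> V" "b \<in> U'" "y \<in> V" "\<Phi> (a, x) = \<Phi> (b, y)"
    then have "coord_dist d (\<theta> a) (\<theta> b) + coord_dist d (\<psi> x) (\<psi> y) = 0"
      using dist[of a x b y] by simp
    then have "coord_dist d (\<theta> a) (\<theta> b) = 0" "coord_dist d (\<psi> x) (\<psi> y) = 0"
      using coord_dist_nonneg[of d "\<theta> a" "\<theta> b"] coord_dist_nonneg[of d "\<psi> x" "\<psi> y"] by linarith+
    then show "a = b \<and> x = y"
      using chart_eqI[OF charts(1)] chart_eqI[OF charts(2)] * by blast
  qed
  have f: "f (\<Phi> (a, x)) = \<phi> (a \<otimes> x)" if "a \<in> U'" "x \<in> V" for a x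
    using that inj by (simp add: f_def mul_def)
  have "\<Phi> (g, h) \<in> \<Phi> ` P"
    using mem by (auto simp: P_def mul_def)
  then obtain e C where "e > 0" "C \<ge> 0"
    and e: "\<And>x. x \<in> topspace (Euclidean_space (d + d)) \<Longrightarrow>
        coord_dist (d + d) x (\<Phi> (g, h)) < e \<Longrightarrow> x \<in> \<Phi> ` P"
    and C: "\<And>x y. x \<in> topspace (Euclidean_space (d + d)) \<Longrightarrow>
        y \<in> topspace (Euclidean_space (d + d)) \<Longrightarrow>
        coord_dist (d + d) x (\<Phi> (g, h)) < e \<Longrightarrow> coord_dist (d + d) y (\<Phi> (g, h)) < e \<Longrightarrow>
        coord_dist d (f x) (f y) \<le> C * coord_dist (d + d) x y"
    using smooth_on_locally_Lipschitz[OF smooth] by blast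
  define N where "N = {a \<in> U'. coord_dist d (\<theta> a) (\<theta> g) < e / 2}"
  define M where "M = {x \<in> V. coord_dist d (\<psi> x) (\<psi> h) < e / 2}"
  have near: "coord_dist (d + d) (\<Phi> (a, x)) (\<Phi> (g, h)) < e" if "a \<in> N" "x \<in> M" for a x
    using that unfolding dist N_def M_def by simp
  show thesis
  proof (rule that)
    show "openin X N" "openin X M"
      unfolding N_def M_def by (rule openin_chart_ball charts)+
    show "g \<in> N" "h \<in> M" "M \<subseteq> V"
      using mem \<open>e > 0\<close> by (auto simp: N_def M_def)
    show "C \<ge> 0" by fact
    show "a \<otimes> x \<in> U" if "a \<in> N" "x \<in> M" for a x
    proof -
      have ax: "(a, x) \<in> U' \<times> V"
        using that by (auto simp: N_def M_def)
      then have "\<Phi> (a, x) \<in> \<Phi> ` P"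
        using e[OF in_E near[OF that]] by blast
      then have "(a, x) \<in> P"
        using inj ax unfolding P_def by (auto dest: inj_onD)
      then show ?thesis
        by (simp add: P_def mul_def)
    qed
    show "coord_dist d (\<phi> (a \<otimes> x)) (\<phi> (a \<otimes> y)) \<le> C * coord_dist d (\<psi> x) (\<psi> y)"
      if "a \<in> N" "x \<in> M" "y \<in> M" for a x y
    proof -
      have "a \<in> U'" "x \<in> V" "y \<in> V"
        using that by (auto simp: N_def M_def)
      then show ?thesis
        using C[OF in_E in_E near near, of a x a y] that by (simp add: f dist)
    qed
  qed
qed

end

section \<open>Continuous representations\<close>

locale lie_group_representation = lie_group G d X \<A>
  for G :: "('g, 'm) monoid_scheme" (structure)
    and d :: nat and X :: "'g topology" and \<A> :: "'g chart set" +
  fixes \<rho> :: "'g \<Rightarrow> 'v \<Rightarrow> 'v::euclidean_space"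
  assumes rep: "continuous_representation G X \<rho>"
begin

lemma rep_linear: "g \<in> carrier G \<Longrightarrow> linear (\<rho> g)"
  and rep_bij: "g \<in> carrier G \<Longrightarrow> bij (\<rho> g)"
  and rep_mult: "g \<in> carrier G \<Longrightarrow> h \<in> carrier G \<Longrightarrow> \<rho> (g \<otimes> h) = \<rho> g \<circ> \<rho> h"
  using rep by (auto simp: continuous_representation_def hom_def general_linear_group_def)

text \<open>\<open>hom\<close> demands only multiplicativity; the image of the unit is an injective
  idempotent, hence the identity.\<close>

lemma rep_one: "\<rho> \<one> = id"
proof -
  have "\<rho> \<one> v = v" for v
  proof (rule injD[OF bij_is_inj[OF rep_bij[OF one_closed]]])
    show "\<rho> \<one> (\<rho> \<one> v) = \<rho> \<one> v"
      using rep_mult[of \<one> \<one>] by (simp add: fun_eq_iff)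
  qed
  then show ?thesis
    by (simp add: fun_eq_iff)
qed

lemma rep_pow: "g \<in> carrier G \<Longrightarrow> \<rho> (g [^] (k::nat)) = \<rho> g ^^ k"
proof (induction k)
  case 0
  then show ?case
    by (simp add: rep_one)
next
  case (Suc k)
  then show ?case
    by (simp add: rep_mult funpow_Suc_right del: funpow.simps)
qed

lemma rep_continuous: "continuous_map X euclidean (\<lambda>g. \<rho> g v)"
proof -
  have "continuous_map X (prod_topology X euclidean) (\<lambda>g. (g, v))"
    by (simp add: continuous_map_pairedI)
  moreover have "continuous_map (prod_topology X euclidean) euclidean (\<lambda>(g, v). \<rho> g v)"
    using rep by (simp add: continuous_representation_def)
  ultimately have "continuous_map X euclidean ((\<lambda>(g, v). \<rho> g v) \<circ> (\<lambda>g. (g, v)))"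
    by (rule continuous_map_compose)
  then show ?thesis
    by (simp add: o_def)
qed

text \<open>Pointwise continuity on the finitely many basis vectors suffices: \<open>F x\<close>
  bounds the operator norm of the difference of \<open>\<rho> x\<close> and
  \<open>\<rho> g\<close>.\<close>

lemma rep_near:
  assumes g: "g \<in> carrier G" and "e > 0"
  obtains N where "openin X N" "g \<in> N" "\<And>x v. x \<in> N \<Longrightarrow> norm (\<rho> x v - \<rho> g v) \<le> e * norm v"
proof -
  define F where "F x = (\<Sum>b\<in>Basis. norm (\<rho> x b - \<rho> g b))" for x
  have "continuous_map X euclideanreal F"
    unfolding F_def
    by (intro continuous_map_sum continuous_map_norm continuous_map_diff rep_continuous) auto
  from openin_continuous_map_preimage[OF this, of "{..<e}"]
  have "openin X {x \<in> carrier G. F x < e}"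
    by (simp add: carrier)
  moreover have "g \<in> {x \<in> carrier G. F x < e}"
    using assms by (simp add: F_def)
  moreover have "norm (\<rho> x v - \<rho> g v) \<le> e * norm v" if "x \<in> {x \<in> carrier G. F x < e}" for x v
  proof -
    have lin: "linear (\<lambda>v. \<rho> x v - \<rho> g v)"
      using that g by (intro linear_compose_sub rep_linear) auto
    have "\<rho> x v - \<rho> g v = (\<lambda>v. \<rho> x v - \<rho> g v) (\<Sum>b\<in>Basis. (v \<bullet> b) *\<^sub>R b)"
      by (simp add: euclidean_representation)
    also have "\<dots> = (\<Sum>b\<in>Basis. (v \<bullet> b) *\<^sub>R (\<rho> x b - \<rho> g b))"
      by (simp only: linear_sum[OF lin] linear_cmul[OF lin])
    finally have "norm (\<rho> x v - \<rho> g v) \<le> (\<Sum>b\<in>Basis. norm ((v \<bullet> b) *\<^sub>R (\<rho> x b - \<rho> g b)))"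
      by (simp only: norm_sum)
    also have "\<dots> \<le> (\<Sum>b\<in>Basis. norm v * norm (\<rho> x b - \<rho> g b))"
      by (intro sum_mono) (auto intro!: mult_right_mono Basis_le_norm)
    also have "\<dots> = F x * norm v"
      by (simp add: F_def sum_distrib_left mult.commute)
    also have "\<dots> \<le> e * norm v"
      using that by (intro mult_right_mono) auto
    finally show ?thesis .
  qed
  ultimately show thesis
    by (rule that)
qed

text \<open>
  If \<open>x\<close> has distance \<open>s\<close> from \<open>\<one>\<close> in coordinates, then \<open>x ^ k\<close> has distance at most \<open>C * k * s\<close>,
  so roughly \<open>1 / s\<close> many powers of \<open>\<rho> x\<close> stay close to the identity; this forces
  \<open>\<rho> x\<close> to be within a constant times \<open>s\<close> of the identity.
\<close>

lemma rep_Lipschitz_at_one: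
  assumes \<phi>: "(U, \<phi>) \<in> \<A>" and one: "\<one> \<in> U"
  obtains r K where "r > 0" "K \<ge> 0"
    "\<And>x v. x \<in> U \<Longrightarrow> coord_dist d (\<phi> x) (\<phi> \<one>) < r \<Longrightarrow>
      norm (\<rho> x v - v) \<le> K * coord_dist d (\<phi> x) (\<phi> \<one>) * norm v"
proof -
  let ?s = "\<lambda>x. coord_dist d (\<phi> x) (\<phi> \<one>)"
  have UG: "U \<subseteq> carrier G"
    using openin_subset[OF chart_props(1)[OF \<phi>]] carrier by simp
  obtain N M C0 where NM: "openin X N" "openin X M" "\<one> \<in> N" "\<one> \<in> M" "M \<subseteq> U" "C0 \<ge> 0"
    and mult_U: "\<And>a y. a \<in> N \<Longrightarrow> y \<in> M \<Longrightarrow> a \<otimes> y \<in> U"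
    and C0: "\<And>a x y. a \<in> N \<Longrightarrow> x \<in> M \<Longrightarrow> y \<in> M \<Longrightarrow>
      coord_dist d (\<phi> (a \<otimes> x)) (\<phi> (a \<otimes> y)) \<le> C0 * coord_dist d (\<phi> x) (\<phi> y)"
    using mult_locally_Lipschitz[OF \<phi> \<phi> \<phi> one one] one by auto
  obtain N' where N': "openin X N'" "\<one> \<in> N'"
    and half: "\<And>x v. x \<in> N' \<Longrightarrow> norm (\<rho> x v - \<rho> \<one> v) \<le> 1 / 2 * norm v"
    using rep_near[of \<one> "1 / 2"] by auto
  have "openin X (N \<inter> M \<inter> N')" "\<one> \<in> N \<inter> M \<inter> N'"
    using NM N' by auto
  then obtain e where "e > 0" and e: "\<And>x. x \<in> U \<Longrightarrow> ?s x < e \<Longrightarrow> x \<in> N \<inter> M \<inter> N'"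
    using chart_ball_within[OF \<phi> _ _ one] by blast
  \<comment> \<open>With \<open>C \<ge> 1\<close> the condition \<open>C * ?s x < e\<close> also
    places \<open>x\<close> itself in the coordinate ball.\<close>
  define C where "C = max 1 C0"
  have "C \<ge> 1" "C0 \<le> C"
    by (auto simp: C_def)
  \<comment> \<open>Compare \<open>x [^] k \<otimes> x\<close> with
    \<open>x [^] k \<otimes> \<one>\<close>: as long as \<open>x [^] k\<close> stays in
    \<open>N\<close>, each further factor adds at most \<open>C * ?s x\<close>.\<close>
  have powers: "x [^] k \<in> U \<and> ?s (x [^] k) \<le> C * k * ?s x"
    if x: "x \<in> U" "?s x < e" and k: "C * k * ?s x < e" for x and k :: nat
    using k
  proof (induction k)
    case 0
    then show ?case
      using one by simp
  next
    case (Suc k)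
    have "C * k * ?s x \<le> C * Suc k * ?s x"
      using \<open>C \<ge> 1\<close> coord_dist_nonneg by (intro mult_right_mono mult_left_mono) auto
    then have IH: "x [^] k \<in> U" "?s (x [^] k) \<le> C * k * ?s x" "?s (x [^] k) < e"
      using Suc by auto
    then have "x [^] k \<in> N"
      using e by blast
    have "x \<in> M"
      using e x by blast
    have xG: "x \<in> carrier G"
      using x UG by blast
    have "?s (x [^] Suc k) \<le> coord_dist d (\<phi> (x [^] k \<otimes> x)) (\<phi> (x [^] k \<otimes> \<one>)) + ?s (x [^] k)"
      using coord_dist_triangle[of d "\<phi> (x [^] k \<otimes> x)" "\<phi> \<one>" "\<phi> (x [^] k)"] xG by simp
    also have "coord_dist d (\<phi> (x [^] k \<otimes> x)) (\<phi> (x [^] k \<otimes> \<one>)) \<le> C0 * ?s x"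
      using C0 \<open>x [^] k \<in> N\<close> \<open>x \<in> M\<close> NM by blast
    also have "C0 * ?s x \<le> C * ?s x"
      using \<open>C0 \<le> C\<close> coord_dist_nonneg by (rule mult_right_mono)
    finally have "?s (x [^] Suc k) \<le> C * Suc k * ?s x"
      using IH(2) by (simp add: algebra_simps)
    moreover have "x [^] Suc k \<in> U"
      using mult_U \<open>x [^] k \<in> N\<close> \<open>x \<in> M\<close> by simp
    ultimately show ?case
      by blast
  qed
  show thesis
  proof (rule that)
    show "e / C > 0" "2 * C / e \<ge> 0"
      using \<open>e > 0\<close> \<open>C \<ge> 1\<close> by auto
    fix x v assume x: "x \<in> U" "?s x < e / C"
    then have Cs: "C * ?s x < e"
      using \<open>C \<ge> 1\<close> by (simp add: field_simps)
    moreover have "?s x \<le> C * ?s x"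
      using \<open>C \<ge> 1\<close> coord_dist_nonneg[of d "\<phi> x" "\<phi> \<one>"] by (simp add: mult_le_cancel_right1)
    ultimately have "?s x < e"
      by linarith
    show "norm (\<rho> x v - v) \<le> 2 * C / e * ?s x * norm v"
    proof (cases "?s x = 0")
      case True
      then have "x = \<one>"
        using chart_eqI[OF \<phi>] x one by blast
      then show ?thesis
        using True by (simp add: rep_one)
    next
      case False
      then have "?s x > 0"
        using coord_dist_nonneg[of d "\<phi> x" "\<phi> \<one>"] by linarith
      define q where "q = e / (C * ?s x)"
      have "q > 1"
        using Cs \<open>?s x > 0\<close> \<open>C \<ge> 1\<close> by (simp add: q_def field_simps)
      \<comment> \<open>The largest natural number strictly below \<open>q\<close>; strictness keeps
        \<open>C * k * ?s x\<close> below \<open>e\<close> for all \<open>k \<le> n\<close>. As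
        \<open>n \<ge> 1\<close>, also \<open>q \<le> n + 1 \<le> 2 * n\<close>, the origin of the
        factor 2 in the constant.\<close>
      define n where "n = nat (\<lceil>q\<rceil> - 1)"
      have n: "n < q" "q \<le> n + 1" "n > 0"
        using \<open>q > 1\<close> unfolding n_def by linarith+
      have Cpos: "C * ?s x > 0"
        using \<open>?s x > 0\<close> \<open>C \<ge> 1\<close> by simp
      have "norm ((\<rho> x ^^ k) w - w) \<le> norm w / 2" if "k \<le> n" for k w
      proof -
        have "k < q"
          using n(1) that by linarith
        then have "C * k * ?s x < e"
          using Cpos by (simp add: q_def pos_less_divide_eq mult_ac)
        then have "x [^] k \<in> U" "?s (x [^] k) < e"
          using powers[OF x(1) \<open>?s x < e\<close>] by force+
        then have "x [^] k \<in> N'"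
          using e by blast
        from half[OF this, of w] show ?thesis
          using x UG by (simp add: rep_pow rep_one subset_iff)
      qed
      then have "norm (\<rho> x v - v) \<le> norm v / n"
        using n(3) x UG by (intro linear_small_powers rep_linear) auto
      also have "1 / n \<le> 2 * C / e * ?s x"
      proof -
        have "q \<le> 2 * n"
          using n by linarith
        then have "e \<le> 2 * n * (C * ?s x)"
          using Cpos by (simp add: q_def pos_divide_le_eq)
        then show ?thesis
          using \<open>e > 0\<close> n(3) by (simp add: field_simps)
      qed
      then have "norm v / n \<le> 2 * C / e * ?s x * norm v"
        using mult_right_mono[OF _ norm_ge_zero[of v]] by fastforce
      finally show ?thesis .
    qed
  qed
qed

text \<open>Translation to the unit: \<open>\<rho> y v - \<rho> x v\<close> is
  \<open>\<rho> x\<close> applied to \<open>\<rho> (inv x \<otimes> y) v - v\<close>, where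
  \<open>inv x \<otimes> y\<close> is close to \<open>\<one>\<close> and \<open>\<rho> x\<close> is
  bounded near \<open>g\<close>.\<close>

lemma rep_locally_Lipschitz:
  assumes \<psi>: "(V, \<psi>) \<in> \<A>" and g: "g \<in> V"
  obtains W K where "openin X W" "g \<in> W"
    "\<And>x y v. x \<in> W \<Longrightarrow> y \<in> W \<Longrightarrow> norm (\<rho> x v - \<rho> y v) \<le> K * coord_dist d (\<psi> x) (\<psi> y) * norm v"
proof -
  have VG: "V \<subseteq> carrier G"
    using openin_subset[OF chart_props(1)[OF \<psi>]] carrier by simp
  then have gG: "g \<in> carrier G"
    using g by blast
  obtain U' \<theta> where \<theta>: "(U', \<theta>) \<in> \<A>" "inv g \<in> U'"
    using chart_at[of "inv g"] gG carrier by auto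
  obtain U \<phi> where \<phi>: "(U, \<phi>) \<in> \<A>" "\<one> \<in> U"
    using chart_at[of "\<one>"] carrier by auto
  obtain r K where "r > 0" "K \<ge> 0" and K: "\<And>x v. x \<in> U \<Longrightarrow> coord_dist d (\<phi> x) (\<phi> \<one>) < r \<Longrightarrow>
      norm (\<rho> x v - v) \<le> K * coord_dist d (\<phi> x) (\<phi> \<one>) * norm v"
    using rep_Lipschitz_at_one[OF \<phi>] by blast
  have "inv g \<otimes> g \<in> U"
    using gG \<phi>(2) by simp
  from mult_locally_Lipschitz[OF \<theta>(1) \<psi> \<phi>(1) \<theta>(2) g this]
  obtain N M C where NM: "openin X N" "openin X M" "inv g \<in> N" "g \<in> M" "M \<subseteq> V" "C \<ge> 0"
    and mult_U: "\<And>a y. a \<in> N \<Longrightarrow> y \<in> M \<Longrightarrow> a \<otimes> y \<in> U"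
    and C: "\<And>a x y. a \<in> N \<Longrightarrow> x \<in> M \<Longrightarrow> y \<in> M \<Longrightarrow>
      coord_dist d (\<phi> (a \<otimes> x)) (\<phi> (a \<otimes> y)) \<le> C * coord_dist d (\<psi> x) (\<psi> y)"
    by metis
  obtain N' where N': "openin X N'" "g \<in> N'"
    and near: "\<And>x v. x \<in> N' \<Longrightarrow> norm (\<rho> x v - \<rho> g v) \<le> 1 * norm v"
    using rep_near[OF gG, of 1] by auto
  define B where "B = 1 + onorm (\<rho> g)"
  have "bounded_linear (\<rho> g)"
    using rep_linear[OF gG] by (simp add: linear_conv_bounded_linear)
  then have B: "norm (\<rho> x w) \<le> B * norm w" if "x \<in> N'" for x w
    using near[OF that, of w] onorm[of "\<rho> g" w] norm_triangle_sub[of "\<rho> x w" "\<rho> g w"]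
    by (simp add: B_def algebra_simps)
  have "B \<ge> 0"
    using onorm_pos_le[OF \<open>bounded_linear (\<rho> g)\<close>] by (simp add: B_def)
  \<comment> \<open>Points of \<open>W\<close> are at most \<open>2 * s\<close> apart, and
    \<open>C * (2 * s) < r\<close>; dividing by \<open>C + 1\<close> is safe even for
    \<open>C = 0\<close>.\<close>
  define s where "s = r / (2 * (C + 1))"
  have "s > 0"
    using \<open>r > 0\<close> \<open>C \<ge> 0\<close> by (simp add: s_def)
  define W where "W = M \<inter> {x \<in> carrier G. inv x \<in> N} \<inter> N' \<inter> {x \<in> V. coord_dist d (\<psi> x) (\<psi> g) < s}"
  have "openin X W"
    unfolding W_def using NM N' by (intro openin_Int openin_inv_vimage openin_chart_ball \<psi>) auto
  moreover have "g \<in> W"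
    unfolding W_def using NM N' gG g \<open>s > 0\<close> by simp
  moreover have "norm (\<rho> x v - \<rho> y v) \<le> B * (K * C) * coord_dist d (\<psi> x) (\<psi> y) * norm v"
    if x: "x \<in> W" and y: "y \<in> W" for x y v
  proof -
    have xyG: "x \<in> carrier G" "y \<in> carrier G"
      using x y by (auto simp: W_def VG subset_iff)
    let ?a = "inv x"
    have "?a \<in> N" "x \<in> M" "y \<in> M"
      using x y by (auto simp: W_def)
    define D where "D = coord_dist d (\<psi> x) (\<psi> y)"
    \<comment> \<open>Left multiplication by \<open>inv x\<close> sends \<open>x\<close> to
      \<open>\<one>\<close>, so the bound measures the distance of \<open>inv x \<otimes> y\<close>
      from \<open>\<one>\<close>.\<close>
    have ay: "coord_dist d (\<phi> (?a \<otimes> y)) (\<phi> \<one>) \<le> C * D"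
      using C[OF \<open>?a \<in> N\<close> \<open>y \<in> M\<close> \<open>x \<in> M\<close>] xyG by (simp add: D_def coord_dist_commute)
    have "D \<le> coord_dist d (\<psi> x) (\<psi> g) + coord_dist d (\<psi> y) (\<psi> g)"
      unfolding D_def using coord_dist_triangle[of d "\<psi> x" "\<psi> y" "\<psi> g"]
      by (simp add: coord_dist_commute)
    then have "D \<le> 2 * s"
      using x y by (simp add: W_def)
    then have "C * D \<le> C * (2 * s)"
      using \<open>C \<ge> 0\<close> by (rule mult_left_mono)
    also have "\<dots> < (C + 1) * (2 * s)"
      using \<open>s > 0\<close> by simp
    also have "\<dots> = r"
      using \<open>C \<ge> 0\<close> by (simp add: s_def field_simps)
    finally have "coord_dist d (\<phi> (?a \<otimes> y)) (\<phi> \<one>) < r"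
      using ay by linarith
    from K[OF mult_U[OF \<open>?a \<in> N\<close> \<open>y \<in> M\<close>] this, of v]
    have "norm (\<rho> (?a \<otimes> y) v - v) \<le> K * coord_dist d (\<phi> (?a \<otimes> y)) (\<phi> \<one>) * norm v" .
    also have "\<dots> \<le> K * (C * D) * norm v"
      using ay \<open>K \<ge> 0\<close> by (intro mult_right_mono mult_left_mono) auto
    finally have 1: "norm (\<rho> (?a \<otimes> y) v - v) \<le> K * (C * D) * norm v" .
    have "\<rho> y v = \<rho> x (\<rho> (?a \<otimes> y) v)"
      using rep_mult[of x "?a \<otimes> y"] xyG by (simp add: m_assoc[symmetric] fun_eq_iff)
    then have "\<rho> y v - \<rho> x v = \<rho> x (\<rho> (?a \<otimes> y) v - v)"
      using linear_diff[OF rep_linear[OF xyG(1)]] by simp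
    then have "norm (\<rho> x v - \<rho> y v) \<le> B * norm (\<rho> (?a \<otimes> y) v - v)"
      using B[of x "\<rho> (?a \<otimes> y) v - v"] x
      by (simp add: W_def norm_minus_commute[of "\<rho> x v"])
    also have "\<dots> \<le> B * (K * (C * D) * norm v)"
      using 1 \<open>B \<ge> 0\<close> by (rule mult_left_mono)
    finally show ?thesis
      by (simp add: D_def mult_ac)
  qed
  ultimately show thesis
    by (rule that)
qed

text \<open>Each group element has a neighbourhood on which the orbit map is Lipschitz in a chart,
  so its piece is null; compactness leaves finitely many pieces.\<close>

lemma negligible_orbit_plus_subspace:
  assumes "compact_space X" and T: "subspace T" "dim T + d < DIM('v)"
  shows "negligible {\<rho> g v + t |g t. g \<in> carrier G \<and> t \<in> T}"
proof -
  define Q where "Q W = {\<rho> g v + t |g t. g \<in> W \<and> t \<in> T}" for W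
  have "\<exists>W. openin X W \<and> g \<in> W \<and> negligible (Q W)" if "g \<in> carrier G" for g
  proof -
    obtain V \<psi> where \<psi>: "(V, \<psi>) \<in> \<A>" "g \<in> V"
      using chart_at[of g] \<open>g \<in> carrier G\<close> carrier by auto
    obtain W K where W: "openin X W" "g \<in> W" and K: "\<And>x y v. x \<in> W \<Longrightarrow> y \<in> W \<Longrightarrow>
        norm (\<rho> x v - \<rho> y v) \<le> K * coord_dist d (\<psi> x) (\<psi> y) * norm v"
      using rep_locally_Lipschitz[OF \<psi>] by blast
    have "norm (\<rho> x v - \<rho> y v) \<le> K * norm v * coord_dist d (\<psi> x) (\<psi> y)" if "x \<in> W" "y \<in> W" for x y
      using K[OF that, of v] by (simp add: mult_ac)
    then have "negligible (Q W)"
      unfolding Q_def by (rule negligible_Lipschitz_plus_subspace[OF T])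
    with W show ?thesis
      by blast
  qed
  then obtain W where W: "\<And>g. g \<in> carrier G \<Longrightarrow> openin X (W g) \<and> g \<in> W g \<and> negligible (Q (W g))"
    by metis
  have "\<forall>U\<in>W ` carrier G. openin X U" "topspace X \<subseteq> \<Union>(W ` carrier G)"
    using W carrier by auto
  then obtain \<F> where \<F>: "finite \<F>" "\<F> \<subseteq> W ` carrier G" "topspace X \<subseteq> \<Union>\<F>"
    using \<open>compact_space X\<close> unfolding compact_space_alt by meson
  have "negligible (\<Union>(Q ` \<F>))"
    using \<F>(1,2) W by (intro negligible_Union) auto
  moreover have "Q (carrier G) \<subseteq> \<Union>(Q ` \<F>)"
    using \<F>(3) carrier by (fastforce simp: Q_def)
  ultimately have "negligible (Q (carrier G))"
    by (rule negligible_subset)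
  then show ?thesis
    by (simp only: Q_def)
qed

text \<open>The indicator function of the orbit of \<open>w\<close> is a function invariant, as no
  continuity is demanded, and it is a function of the values of \<open>S\<close>.\<close>

lemma same_orbit:
  assumes basis: "function_basis G \<rho> S" and eq: "\<And>p. p \<in> S \<Longrightarrow> p v = p w"
  obtains g where "g \<in> carrier G" "v = \<rho> g w"
proof -
  define f :: "'v \<Rightarrow> real" where "f u = (if \<exists>g\<in>carrier G. u = \<rho> g w then 1 else 0)" for u
  have "(\<exists>g\<in>carrier G. \<rho> h u = \<rho> g w) \<longleftrightarrow> (\<exists>g\<in>carrier G. u = \<rho> g w)" if h: "h \<in> carrier G" for h u
  proof
    assume "\<exists>g\<in>carrier G. u = \<rho> g w"
    then obtain g where "g \<in> carrier G" "u = \<rho> g w"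
      by blast
    then have "\<rho> h u = \<rho> (h \<otimes> g) w"
      using h by (simp add: rep_mult)
    then show "\<exists>g\<in>carrier G. \<rho> h u = \<rho> g w"
      using h \<open>g \<in> carrier G\<close> by blast
  next
    assume "\<exists>g\<in>carrier G. \<rho> h u = \<rho> g w"
    then obtain g where g: "g \<in> carrier G" "\<rho> h u = \<rho> g w"
      by blast
    have "\<rho> (inv h) (\<rho> h u) = u"
      using rep_mult[of "inv h" h] h by (simp add: rep_one fun_eq_iff)
    then have "u = \<rho> (inv h \<otimes> g) w"
      using g h by (simp add: rep_mult)
    then show "\<exists>g\<in>carrier G. u = \<rho> g w"
      using h g(1) by blast
  qed
  then have "f \<in> function_invariants G \<rho>"
    by (simp add: function_invariants_def f_def)
  then obtain F where F: "\<And>u. f u = F (\<lambda>p\<in>S. p u)"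
    using basis unfolding function_basis_def by blast
  have "(\<lambda>p\<in>S. p v) = (\<lambda>p\<in>S. p w)"
    using eq by (rule restrict_ext)
  then have "f v = f w"
    by (simp add: F)
  moreover have "f w = 1"
    using rep_one by (force simp: f_def)
  ultimately show thesis
    using that by (auto simp: f_def split: if_splits)
qed

end

theorem theorem2:
  fixes G :: "('g, 'm) monoid_scheme"
    and d n :: nat
    and X :: "'g topology"
    and \<A> :: "'g chart set"
    and \<rho> :: "'g \<Rightarrow> 'v \<Rightarrow> 'v::euclidean_space"
    and S :: "('v \<Rightarrow> real) set"
  assumes "compact_lie_group G d X \<A>"
    and "DIM('v) = n"
    and "d < n"
    and "continuous_representation G X \<rho>"
    and "polynomial_function_basis G \<rho> S"
  shows "card S \<ge> n - d"
proof (rule ccontr)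
  assume "\<not> card S \<ge> n - d"
  then have small: "card S + d < DIM('v)"
    using assms(2,3) by linarith
  interpret compact_lie_group G d X \<A>
    by (rule assms(1))
  interpret lie_group_representation G d X \<A> \<rho>
    by unfold_locales (rule assms(4))
  have S: "finite S" "function_basis G \<rho> S" "\<And>p. p \<in> S \<Longrightarrow> real_polynomial_function p"
    using assms(5) by (auto simp: polynomial_function_basis_def polynomial_invariants_def)
  have "\<forall>p\<in>S. \<exists>D. (\<forall>x. (p has_derivative (\<lambda>h. D x \<bullet> h)) (at x)) \<and> continuous_on UNIV D"
    using real_polynomial_function_gradient[OF S(3)] by blast
  from bchoice[OF this] obtain D where
    "\<forall>p\<in>S. (\<forall>x. (p has_derivative (\<lambda>h. D p x \<bullet> h)) (at x)) \<and> continuous_on UNIV (D p)" ..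
  then have D: "\<And>p x. p \<in> S \<Longrightarrow> (p has_derivative (\<lambda>h. D p x \<bullet> h)) (at x)"
    "\<And>p. p \<in> S \<Longrightarrow> continuous_on UNIV (D p)"
    by auto
  obtain x0 T W where T: "subspace T" "dim T \<le> card S" and W: "open W" "W \<noteq> {}"
    "W \<subseteq> {x + t |x t. (\<forall>p\<in>S. p x = p x0) \<and> t \<in> T}"
  proof (rule fibre_plus_subspace_contains_open[of S D])
    show "finite S" by (rule S(1))
  qed (use D in simp_all)
  \<comment> \<open>The fibre of \<open>x0\<close> is contained in its orbit, so the open set
    \<open>W\<close> lies in orbit plus \<open>T\<close>, which is null because
    \<open>dim T + d \<le> card S + d < DIM('v)\<close>.\<close>
  have sub: "{x + t |x t. (\<forall>p\<in>S. p x = p x0) \<and> t \<in> T}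
      \<subseteq> {\<rho> g x0 + t |g t. g \<in> carrier G \<and> t \<in> T}"
  proof clarify
    fix x t assume x: "\<forall>p\<in>S. p x = p x0" and "t \<in> T"
    obtain g where "g \<in> carrier G" "x = \<rho> g x0"
      by (rule same_orbit[OF S(2), of x x0]) (use x in auto)
    with \<open>t \<in> T\<close> show "\<exists>g t'. x + t = \<rho> g x0 + t' \<and> g \<in> carrier G \<and> t' \<in> T"
      by blast
  qed
  have "negligible {\<rho> g x0 + t |g t. g \<in> carrier G \<and> t \<in> T}"
    by (rule negligible_orbit_plus_subspace[OF compact T(1)]) (use T(2) small in linarith)
  then have "negligible W"
    by (rule negligible_subset) (rule order_trans[OF W(3) sub])
  with W(1,2) show False
    by (simp add: open_not_negligible)
qed

end
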